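(* Let $0 \le \alpha < 1$ and $\beta > 2$, and let $\Sigma$ be the intermediate beta shift associated to $(\alpha,\beta)$, with lexicographically smallest sequence $a$ and lexicographically largest sequence $b$. The subshift $\Sigma$ has specification if and only if the sets $$\mathsf{D}(a) = \{ n \in \mathbb{N} : (b_1,\dots,b_n) = (a_j,\dots,a_{j+n-1}) \text{ for some } j \in \mathbb{N} \}$$ and $$\mathsf{D}(b) = \{ n \in \mathbb{N} : (a_1,\dots,a_n) = (b_j,\dots,b_{j+n-1}) \text{ for some } j \in \mathbb{N} \}$$ are both bounded.
   Context: $\mathbb{N} = \{1,2,3,\dots\}$. For $0 \le \alpha < 1$ and $\beta > 1$ define $F : [0,1) \to [0,1)$ by $F(x) = \beta x + \alpha - \lfloor \beta x + \alpha \rfloor$. Put $\ell = \lceil \alpha + \beta \rceil - 1$ and partition $[0,1)$ into $J_0 = [0, \frac{1-\alpha}{\beta})$, $J_i = [\frac{i-\alpha}{\beta}, \frac{i+1-\alpha}{\beta})$ for $0 < i < \ell$, and $J_\ell = [\frac{\ell-\alpha}{\beta}, 1)$. For $x \in [0,1)$ let $\Omega(x) \in \{0,\dots,\ell\}^{\mathbb{N}}$ be the sequence with $\Omega(x)_n = i$ if and only if $F^{n-1}(x) \in J_i$. The intermediate beta shift $\Sigma$ associated to $(\alpha,\beta)$ is the closure of $\Omega([0,1))$ in $\{0,\dots,\ell\}^{\mathbb{N}}$ (product topology), with the shift map $(\sigma x)_n = x_{n+1}$. The sequences $a$ and $b$ are the infimum and supremum of $\Sigma$ in the lexicographic order; equivalently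 $a = \Omega(0)$ and $b = \lim_{x \nearrow 1} \Omega(x)$. The language $\mathcal{L}$ of a subshift $\Sigma$ is the set of all finite words $w$ such that some $x \in \Sigma$ satisfies $(x_1,\dots,x_{|w|}) = w$; $\mathcal{L}_n$ is the set of words in $\mathcal{L}$ of length $n$. A set $\mathcal{G} \subset \mathcal{L}$ has specification when there is $\tau \in \mathbb{N}$ such that for any words $w^0,\dots,w^n$ in $\mathcal{G}$ (any $n$) there are words $v^1,\dots,v^n \in \mathcal{L}_\tau$ such that the concatenation $w^0 v^1 w^1 \cdots w^{n-1} v^n w^n$ belongs to $\mathcal{L}$. The subshift $\Sigma$ has specification when its language $\mathcal{L}$ has specification. *)

theory Defs
  imports "HOL-Analysis.Analysis" "HOL-Library.Fun_Lexorder"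
begin

text \<open>
  One-sided sequences \<open>(x\<^sub>1, x\<^sub>2, x\<^sub>3, \<dots>)\<close> of natural numbers are functions \<open>x :: nat \<Rightarrow> nat\<close>, where the
  index is shifted by one: \<open>x n\<close> is the symbol \<open>x\<^sub>n\<^sub>+\<^sub>1\<close>. Finite words are lists.
\<close>

subsection \<open>Intermediate beta shifts\<close>

definition beta_map :: "real \<Rightarrow> real \<Rightarrow> real \<Rightarrow> real" where
  "beta_map \<alpha> \<beta> x = \<beta> * x + \<alpha> - of_int \<lfloor>\<beta> * x + \<alpha>\<rfloor>"

definition max_digit :: "real \<Rightarrow> real \<Rightarrow> nat" where
  "max_digit \<alpha> \<beta> = nat (\<lceil>\<alpha> + \<beta>\<rceil> - 1)"

definition beta_interval :: "real \<Rightarrow> real \<Rightarrow> nat \<Rightarrow> real set" where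
  "beta_interval \<alpha> \<beta> i =
     (if i = 0 then {0 ..< (1 - \<alpha>) / \<beta>}
      else if i < max_digit \<alpha> \<beta> then {(real i - \<alpha>) / \<beta> ..< (real i + 1 - \<alpha>) / \<beta>}
      else {(real (max_digit \<alpha> \<beta>) - \<alpha>) / \<beta> ..< 1})"

text \<open>
  The coding \<open>\<Omega>\<close>. That the intervals partition \<open>[0,1)\<close>, so that the description is proper, is
  \<open>itinerary_eq_iff\<close> below.
\<close>

definition itinerary :: "real \<Rightarrow> real \<Rightarrow> real \<Rightarrow> nat \<Rightarrow> nat" where
  "itinerary \<alpha> \<beta> x n =
     (THE i. i \<le> max_digit \<alpha> \<beta> \<and> (beta_map \<alpha> \<beta> ^^ n) x \<in> beta_interval \<alpha> \<beta> i)"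

text \<open>
  The closure is taken in the product topology on \<open>nat \<Rightarrow> nat\<close>, with \<open>nat\<close> discrete. As the sequences
  over \<open>{0..\<ell>}\<close> form a closed subspace, it agrees with the closure there.
\<close>

definition beta_shift :: "real \<Rightarrow> real \<Rightarrow> (nat \<Rightarrow> nat) set" where
  "beta_shift \<alpha> \<beta> = closure (itinerary \<alpha> \<beta> ` {0 ..< 1})"


subsection \<open>Languages and the specification property\<close>

definition subword :: "(nat \<Rightarrow> nat) \<Rightarrow> nat \<Rightarrow> nat \<Rightarrow> nat list" where
  "subword x i n = map x [i ..< i + n]"

definition language :: "(nat \<Rightarrow> nat) set \<Rightarrow> nat list set" where
  "language X = {w. \<exists>x\<in>X. subword x 0 (length w) = w}"

text \<open>
  Specification of a set of words \<open>G\<close> inside a language \<open>L\<close>. The case \<open>n = 0\<close> forces \<open>G \<subseteq> L\<close>.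
\<close>

definition words_have_spec :: "nat list set \<Rightarrow> nat list set \<Rightarrow> bool" where
  "words_have_spec L G \<longleftrightarrow>
     (\<exists>\<tau>\<ge>1. \<forall>n. \<forall>w :: nat \<Rightarrow> nat list. (\<forall>i\<le>n. w i \<in> G) \<longrightarrow>
        (\<exists>v :: nat \<Rightarrow> nat list. (\<forall>i\<in>{1..n}. v i \<in> L \<and> length (v i) = \<tau>) \<and>
           w 0 @ concat (map (\<lambda>i. v i @ w i) [1 ..< n + 1]) \<in> L))"

definition shift_has_spec :: "(nat \<Rightarrow> nat) set \<Rightarrow> bool" where
  "shift_has_spec X \<longleftrightarrow> words_have_spec (language X) (language X)"


subsection \<open>Lexicographic extrema\<close>

definition lex_least :: "(nat \<Rightarrow> nat) set \<Rightarrow> (nat \<Rightarrow> nat) \<Rightarrow> bool" where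
  "lex_least X a \<longleftrightarrow> a \<in> X \<and> (\<forall>x\<in>X. a = x \<or> less_fun a x)"

definition lex_greatest :: "(nat \<Rightarrow> nat) set \<Rightarrow> (nat \<Rightarrow> nat) \<Rightarrow> bool" where
  "lex_greatest X b \<longleftrightarrow> b \<in> X \<and> (\<forall>x\<in>X. x = b \<or> less_fun x b)"


subsection \<open>Well-definedness\<close>

lemma beta_map_bounds: "beta_map \<alpha> \<beta> x \<in> {0 ..< 1}"
  unfolding beta_map_def by (simp, linarith)

lemma beta_interval_iff_floor:
  assumes "0 \<le> \<alpha>" "\<alpha> < 1" "1 < \<beta>" "y \<in> {0 ..< 1}" "i \<le> max_digit \<alpha> \<beta>"
  shows "y \<in> beta_interval \<alpha> \<beta> i \<longleftrightarrow> \<lfloor>\<beta> * y + \<alpha>\<rfloor> = int i"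
proof -
  let ?l = "max_digit \<alpha> \<beta>"
  have l: "int ?l = \<lceil>\<alpha> + \<beta>\<rceil> - 1" "?l \<ge> 1"
    using assms unfolding max_digit_def by linarith+
  have up: "\<beta> * y + \<alpha> < real ?l + 1"
  proof -
    have "\<beta> * y < \<beta>" using assms by simp
    then show ?thesis using l by linarith
  qed
  have lo: "\<alpha> \<le> \<beta> * y + \<alpha>" using assms by simp
  have fl: "\<lfloor>\<beta> * y + \<alpha>\<rfloor> = int i \<longleftrightarrow> real i \<le> \<beta> * y + \<alpha> \<and> \<beta> * y + \<alpha> < real i + 1"
    by linarith
  have b: "\<beta> > 0" using assms by simp
  have eqs: "(c - \<alpha>) / \<beta> \<le> y \<longleftrightarrow> c \<le> \<beta> * y + \<alpha>"
            "y < (c - \<alpha>) / \<beta> \<longleftrightarrow> \<beta> * y + \<alpha> < c" for c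
    using b by (auto simp: field_simps)
  consider "i = 0" | "0 < i" "i < ?l" | "0 < i" "i = ?l" using assms by linarith
  then show ?thesis
    using up lo l assms unfolding fl beta_interval_def
    by cases (auto simp: eqs)
qed

lemma itinerary_eq_iff:
  assumes "0 \<le> \<alpha>" "\<alpha> < 1" "1 < \<beta>" "x \<in> {0 ..< 1}"
  shows "itinerary \<alpha> \<beta> x n \<le> max_digit \<alpha> \<beta>"
    and "i \<le> max_digit \<alpha> \<beta> \<Longrightarrow>
           itinerary \<alpha> \<beta> x n = i \<longleftrightarrow> (beta_map \<alpha> \<beta> ^^ n) x \<in> beta_interval \<alpha> \<beta> i"
proof -
  define y where "y = (beta_map \<alpha> \<beta> ^^ n) x"
  have y: "y \<in> {0 ..< 1}"
    unfolding y_def using assms(4) beta_map_bounds by (cases n) auto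
  have ge: "0 \<le> \<beta> * y + \<alpha>" and le: "\<beta> * y < \<beta>"
    using y assms by auto
  define k where "k = nat \<lfloor>\<beta> * y + \<alpha>\<rfloor>"
  have k: "int k = \<lfloor>\<beta> * y + \<alpha>\<rfloor>" using ge unfolding k_def by simp
  have kl: "k \<le> max_digit \<alpha> \<beta>" using k le assms unfolding max_digit_def by linarith
  have iff: "y \<in> beta_interval \<alpha> \<beta> i \<longleftrightarrow> i = k" if "i \<le> max_digit \<alpha> \<beta>" for i
    using beta_interval_iff_floor[OF assms(1-3) y that] k by auto
  have "itinerary \<alpha> \<beta> x n = k"
    unfolding itinerary_def y_def[symmetric]
    by (rule the_equality) (use iff kl in blast)+
  then show "itinerary \<alpha> \<beta> x n \<le> max_digit \<alpha> \<beta>"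
    and "i \<le> max_digit \<alpha> \<beta> \<Longrightarrow>
           itinerary \<alpha> \<beta> x n = i \<longleftrightarrow> (beta_map \<alpha> \<beta> ^^ n) x \<in> beta_interval \<alpha> \<beta> i"
    using iff kl unfolding y_def by auto
qed

lemma closed_coordinate: "closed {x :: nat \<Rightarrow> nat. P (x n)}"
proof -
  have "closed ((\<lambda>x :: nat \<Rightarrow> nat. x n) -` {k. P k})"
    by (intro closed_vimage) (auto intro: continuous_on_product_coordinates simp: closed_def open_discrete)
  then show ?thesis by (simp add: vimage_def)
qed

lemma beta_shift_le_max_digit:
  assumes "0 \<le> \<alpha>" "\<alpha> < 1" "1 < \<beta>" "x \<in> beta_shift \<alpha> \<beta>"
  shows "x n \<le> max_digit \<alpha> \<beta>"
proof -
  have "beta_shift \<alpha> \<beta> \<subseteq> {x. x n \<le> max_digit \<alpha> \<beta>}"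
    unfolding beta_shift_def
    by (rule closure_minimal)
      (use itinerary_eq_iff(1)[OF assms(1-3)] closed_coordinate in auto)
  then show ?thesis using assms(4) by auto
qed

lemma mem_closed_if_prefixes:
  fixes a :: "nat \<Rightarrow> nat"
  assumes "closed X" "\<And>n. \<exists>x\<in>X. \<forall>i<n. x i = a i"
  shows "a \<in> X"
proof -
  from assms(2) obtain f where f: "\<And>n. f n \<in> X" "\<And>n i. i < n \<Longrightarrow> f n i = a i" by metis
  have "limitin (product_topology (\<lambda>_. euclidean) UNIV) f a sequentially"
    unfolding limitin_componentwise
  proof (intro conjI ballI)
    fix i
    have "eventually (\<lambda>n. f n i = a i) sequentially"
      using f(2) by (auto intro: eventually_sequentiallyI[of "Suc i"])
    then show "limitin euclidean (\<lambda>n. f n i) (a i) sequentially"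
      by (simp add: tendsto_eventually)
  qed auto
  then have "f \<longlonglongrightarrow> a" by (simp add: euclidean_product_topology)
  then show ?thesis using closed_sequentially[OF assms(1)] f(1) by blast
qed

lemma extremal_sequence:
  fixes X :: "(nat \<Rightarrow> nat) set" and c :: "nat set \<Rightarrow> nat"
  assumes "closed X" "X \<noteq> {}"
    and c: "\<And>n Y. Y \<subseteq> X \<Longrightarrow> Y \<noteq> {} \<Longrightarrow> c ((\<lambda>x. x n) ` Y) \<in> (\<lambda>x. x n) ` Y"
  shows "\<exists>a\<in>X. \<forall>n. a n = c ((\<lambda>x. x n) ` {x\<in>X. \<forall>i<n. x i = a i})"
proof -
  define g where "g Y n = {x\<in>Y. x n = c ((\<lambda>x. x n) ` Y)}" for Y :: "(nat \<Rightarrow> nat) set" and n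
  define S where "S = rec_nat X (\<lambda>n Y. g Y n)"
  have S0: "S 0 = X" and SS: "S (Suc n) = g (S n) n" for n by (simp_all add: S_def)
  have S: "S n \<subseteq> X \<and> S n \<noteq> {}" for n
  proof (induction n)
    case 0 then show ?case using assms S0 by simp
  next
    case (Suc n)
    then have "c ((\<lambda>x. x n) ` S n) \<in> (\<lambda>x. x n) ` S n" using c by blast
    then show ?case using Suc unfolding SS g_def by fastforce
  qed
  define a where "a n = c ((\<lambda>x. x n) ` S n)" for n
  have Seq: "S n = {x\<in>X. \<forall>i<n. x i = a i}" for n
    by (induction n) (auto simp: S0 SS g_def a_def less_Suc_eq)
  show ?thesis
  proof (rule bexI[of _ a], rule allI)
    show "a \<in> X"
    proof (rule mem_closed_if_prefixes[OF assms(1)])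
      fix n
      have "{x\<in>X. \<forall>i<n. x i = a i} \<noteq> {}" using S[of n] Seq[of n] by simp
      then show "\<exists>x\<in>X. \<forall>i<n. x i = a i" by auto
    qed
    show "a n = c ((\<lambda>x. x n) ` {x\<in>X. \<forall>i<n. x i = a i})" for n
      using Seq[of n] a_def[of n] by argo
  qed
qed

lemma first_difference:
  fixes x a :: "nat \<Rightarrow> nat"
  assumes "x \<noteq> a"
  obtains k where "x k \<noteq> a k" "\<forall>i<k. x i = a i"
proof -
  from assms obtain k where "x k \<noteq> a k" by auto
  then have "x (LEAST k. x k \<noteq> a k) \<noteq> a (LEAST k. x k \<noteq> a k)" by (rule LeastI)
  moreover have "\<forall>i<(LEAST k. x k \<noteq> a k). x i = a i" using not_less_Least by blast
  ultimately show ?thesis using that by blast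
qed

lemma lex_least_unique: "lex_least X a \<Longrightarrow> lex_least X a' \<Longrightarrow> a = a'"
  by (metis less_fun_asym lex_least_def)

lemma lex_greatest_unique: "lex_greatest X b \<Longrightarrow> lex_greatest X b' \<Longrightarrow> b = b'"
  by (metis less_fun_asym lex_greatest_def)

lemma ex_lex_least:
  assumes "closed X" "X \<noteq> {}"
  shows "\<exists>a. lex_least X a"
proof -
  have "Inf ((\<lambda>x. x n) ` Y) \<in> (\<lambda>x. x n) ` Y" if "Y \<noteq> {}" for n and Y :: "(nat \<Rightarrow> nat) set"
    by (rule Inf_nat_def1) (use that in simp)
  then have "\<exists>a\<in>X. \<forall>n. a n = Inf ((\<lambda>x. x n) ` {x\<in>X. \<forall>i<n. x i = a i})"
    by (rule extremal_sequence[OF assms])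
  then obtain a where a: "a \<in> X" "\<forall>n. a n = Inf ((\<lambda>x. x n) ` {x\<in>X. \<forall>i<n. x i = a i})"
    by (rule bexE)
  have "a = x \<or> less_fun a x" if "x \<in> X" for x
  proof (cases "x = a")
    case False
    then obtain k where k: "x k \<noteq> a k" "\<forall>i<k. x i = a i" by (rule first_difference)
    have "Inf ((\<lambda>x. x k) ` {x\<in>X. \<forall>i<k. x i = a i}) \<le> x k"
      by (rule cInf_lower) (use that k in auto)
    then have "a k < x k" unfolding a(2)[rule_format, of k, symmetric] using k(1) by simp
    then show ?thesis using k(2) unfolding less_fun_def by metis
  qed simp
  then show ?thesis using a(1) unfolding lex_least_def by blast
qed

lemma ex_lex_greatest:
  assumes "closed X" "X \<noteq> {}" and bd: "\<And>x n. x \<in> X \<Longrightarrow> x n \<le> N"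
  shows "\<exists>b. lex_greatest X b"
proof -
  have fin: "finite ((\<lambda>x. x n) ` Y)" if "Y \<subseteq> X" for n Y
    by (rule finite_subset[of _ "{..N}"]) (use bd that in auto)
  have "Max ((\<lambda>x. x n) ` Y) \<in> (\<lambda>x. x n) ` Y" if "Y \<subseteq> X" "Y \<noteq> {}" for n Y
    by (rule Max_in[OF fin]) (use that in simp_all)
  then have "\<exists>b\<in>X. \<forall>n. b n = Max ((\<lambda>x. x n) ` {x\<in>X. \<forall>i<n. x i = b i})"
    by (rule extremal_sequence[OF assms(1,2)])
  then obtain b where b: "b \<in> X" "\<forall>n. b n = Max ((\<lambda>x. x n) ` {x\<in>X. \<forall>i<n. x i = b i})"
    by (rule bexE)
  have "x = b \<or> less_fun x b" if "x \<in> X" for x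
  proof (cases "x = b")
    case False
    then obtain k where k: "x k \<noteq> b k" "\<forall>i<k. x i = b i" by (rule first_difference)
    have "x k \<le> Max ((\<lambda>x. x k) ` {x\<in>X. \<forall>i<k. x i = b i})"
      by (rule Max_ge[OF fin]) (use that k in auto)
    then have "x k < b k" unfolding b(2)[rule_format, of k, symmetric] using k(1) by simp
    then show ?thesis using k(2) unfolding less_fun_def by metis
  qed simp
  then show ?thesis using b(1) unfolding lex_greatest_def by blast
qed

lemma beta_shift_extrema:
  assumes "0 \<le> \<alpha>" "\<alpha> < 1" "1 < \<beta>"
  shows "\<exists>!a. lex_least (beta_shift \<alpha> \<beta>) a" "\<exists>!b. lex_greatest (beta_shift \<alpha> \<beta>) b"
proof -
  have cl: "closed (beta_shift \<alpha> \<beta>)" and ne: "beta_shift \<alpha> \<beta> \<noteq> {}"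
    by (auto simp: beta_shift_def)
  show "\<exists>!a. lex_least (beta_shift \<alpha> \<beta>) a"
    using ex_lex_least[OF cl ne] lex_least_unique by blast
  have "\<exists>b. lex_greatest (beta_shift \<alpha> \<beta>) b"
    by (rule ex_lex_greatest[OF cl ne, where N = "max_digit \<alpha> \<beta>"])
      (rule beta_shift_le_max_digit[OF assms])
  then show "\<exists>!b. lex_greatest (beta_shift \<alpha> \<beta>) b"
    using lex_greatest_unique by blast
qed

end

theory Submission
  imports Defs
begin

text \<open>
  The images \<open>F\<^sup>n(I\<^sub>w)\<close> of the cylinders \<open>I\<^sub>w\<close> are half-open intervals whose endpoints lie on the
  orbit of \<open>0\<close> and on the left-limit orbit of \<open>1\<close>; a word can be followed by everything as soon as
  this interval is \<open>[0,1)\<close>. If the prefixes of \<open>b\<close> occurring in \<open>a\<close>, and those of \<open>a\<close> occurring in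
  \<open>b\<close>, have bounded length, then the itineraries of the two endpoints separate after boundedly many
  steps, and then one endpoint can be replaced by \<open>0\<close> or \<open>1\<close> while the other one is among
  finitely many orbit points. So the interval has length bounded below, and as \<open>\<beta> > 2\<close> it grows to
  \<open>[0,1)\<close> in bounded time. Conversely, if the first \<open>n\<close> symbols of \<open>b\<close> occur in \<open>a\<close> at position \<open>j\<close>,
  then the prefix of \<open>a\<close> of length \<open>j\<close> can only be followed by these \<open>n\<close> symbols, which contradicts
  specification with gap \<open>\<tau> < n\<close>.
\<close>

section \<open>Subwords, and the language of a closure\<close>

lemma length_subword [simp]: "length (subword x i n) = n"
  by (simp add: subword_def)

lemma nth_subword [simp]: "k < n \<Longrightarrow> subword x i n ! k = x (i + k)"
  by (simp add: subword_def)

lemma subword_Suc: "subword x i (Suc n) = subword x i n @ [x (i + n)]"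
  by (simp add: subword_def)

lemma subword_eq_iff: "subword x i n = subword y j n \<longleftrightarrow> (\<forall>k<n. x (i + k) = y (j + k))"
  by (auto simp: list_eq_iff_nth_eq)

lemma subword_eq_list_iff: "subword x 0 (length w) = w \<longleftrightarrow> (\<forall>k<length w. x k = w ! k)"
  by (auto simp: list_eq_iff_nth_eq)

text \<open>Fixing finitely many coordinates is an open condition, so a point of the closure shares
  each of its prefixes with a point of \<open>X\<close>.\<close>

lemma language_closure: "language (closure X) = language X"
proof
  show "language (closure X) \<subseteq> language X"
  proof
    fix w assume "w \<in> language (closure X)"
    then obtain x where x: "x \<in> closure X" "\<forall>k<length w. x k = w ! k"
      unfolding language_def subword_eq_list_iff by blast
    define U where "U = (\<Inter>k<length w. {y :: nat \<Rightarrow> nat. y k = w ! k})"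
    have "open {y :: nat \<Rightarrow> nat. y k = w ! k}" for k
      using closed_coordinate[of "\<lambda>i. i \<noteq> w ! k" k] by (simp add: closed_def Compl_eq)
    then have "open U"
      unfolding U_def by (intro open_INT) auto
    moreover have "x \<in> U" using x(2) by (simp add: U_def)
    ultimately have "U \<inter> X \<noteq> {}"
      using x(1) open_Int_closure_eq_empty by blast
    then show "w \<in> language X"
      unfolding language_def subword_eq_list_iff U_def by auto
  qed
  show "language X \<subseteq> language (closure X)"
    using closure_subset unfolding language_def by blast
qed

locale intermediate_beta =
  fixes \<alpha> \<beta> :: real
  assumes \<alpha>_nonneg: "0 \<le> \<alpha>" and \<alpha>_less_1: "\<alpha> < 1" and \<beta>_gt_1: "1 < \<beta>"
begin

subsection \<open>Follower intervals\<close>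

text \<open>
  The branch of \<open>F\<close> on \<open>J\<^sub>i\<close> maps \<open>[c,d) \<inter> J\<^sub>i\<close> onto \<open>[lower c i, upper d i)\<close>, which is to be read
  as empty if \<open>lower c i \<ge> upper d i\<close>.
\<close>

definition lower :: "real \<Rightarrow> nat \<Rightarrow> real" where
  "lower c i = max 0 (\<beta> * c + \<alpha> - real i)"

definition upper :: "real \<Rightarrow> nat \<Rightarrow> real" where
  "upper d i = min 1 (\<beta> * d + \<alpha> - real i)"

text \<open>Nonemptiness of the interval reached from [c,d) along \<open>w\<close>. Only the final
  endpoints are compared, since an empty interval never becomes nonempty again
  (\<open>admissible_imp_less\<close>).\<close>

definition admissible :: "real \<Rightarrow> real \<Rightarrow> nat list \<Rightarrow> bool" where
  "admissible c d w \<longleftrightarrow> foldl lower c w < foldl upper d w"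

lemma lower_mono: "c \<le> c' \<Longrightarrow> lower c i \<le> lower c' i"
  unfolding lower_def using \<beta>_gt_1 by (intro max.mono) simp_all

lemma upper_mono: "d \<le> d' \<Longrightarrow> upper d i \<le> upper d' i"
  unfolding upper_def using \<beta>_gt_1 by (intro min.mono) simp_all

lemma foldl_lower_mono: "c \<le> c' \<Longrightarrow> foldl lower c w \<le> foldl lower c' w"
  by (induction w arbitrary: c c') (simp_all add: lower_mono)

lemma foldl_upper_mono: "d \<le> d' \<Longrightarrow> foldl upper d w \<le> foldl upper d' w"
  by (induction w arbitrary: d d') (simp_all add: upper_mono)

lemma foldl_lower_nonneg: "0 \<le> c \<Longrightarrow> 0 \<le> foldl lower c w"
  by (induction w arbitrary: c) (auto simp: lower_def)

lemma foldl_upper_le_1: "d \<le> 1 \<Longrightarrow> foldl upper d w \<le> 1"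
  by (induction w arbitrary: d) (auto simp: upper_def)

lemma admissible_mono: "admissible c d w \<Longrightarrow> c' \<le> c \<Longrightarrow> d \<le> d' \<Longrightarrow> admissible c' d' w"
  unfolding admissible_def
  using foldl_lower_mono[of c' c w] foldl_upper_mono[of d d' w] by linarith

lemma lower_less_upper:
  assumes "lower c i < upper d i"
  shows "c < d"
proof -
  have "\<beta> * c < \<beta> * d" using assms by (auto simp: lower_def upper_def)
  then show ?thesis using \<beta>_gt_1 by simp
qed

lemma admissible_imp_less: "admissible c d w \<Longrightarrow> c < d"
  unfolding admissible_def by (induction w arbitrary: c d) (auto dest: lower_less_upper)

lemma admissible_append:
  "admissible c d (u @ v) \<longleftrightarrow> admissible (foldl lower c u) (foldl upper d u) v"
  by (simp add: admissible_def)

lemma admissible_appendD1: "admissible c d (u @ v) \<Longrightarrow> admissible c d u"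
  unfolding admissible_append using admissible_imp_less admissible_def by blast

lemma admissible_appendD2: "admissible 0 1 (u @ v) \<Longrightarrow> admissible 0 1 v"
  unfolding admissible_append
  by (erule admissible_mono) (simp_all add: foldl_lower_nonneg foldl_upper_le_1)

subsection \<open>Words of the beta shift\<close>

lemma funpow_beta_map_mem: "x \<in> {0..<1} \<Longrightarrow> (beta_map \<alpha> \<beta> ^^ n) x \<in> {0..<1}"
  using beta_map_bounds by (cases n) auto

lemma itinerary_iff_floor:
  assumes "x \<in> {0..<1}"
  shows "itinerary \<alpha> \<beta> x n = i \<longleftrightarrow> \<lfloor>\<beta> * (beta_map \<alpha> \<beta> ^^ n) x + \<alpha>\<rfloor> = int i"
proof -
  note it = itinerary_eq_iff[OF \<alpha>_nonneg \<alpha>_less_1 \<beta>_gt_1 assms]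
  note fl = beta_interval_iff_floor[OF \<alpha>_nonneg \<alpha>_less_1 \<beta>_gt_1 funpow_beta_map_mem[OF assms]]
  have "\<lfloor>\<beta> * (beta_map \<alpha> \<beta> ^^ n) x + \<alpha>\<rfloor> = int (itinerary \<alpha> \<beta> x n)"
    using it fl by blast
  then show ?thesis by auto
qed

text \<open>Ties the computed endpoints to the dynamics: the interval is the image of the cylinder
  of \<open>w\<close>. Symbols are appended on the right because the last one is decided by the last
  iterate.\<close>

lemma follower_interval:
  "z \<in> {foldl lower 0 w..<foldl upper 1 w} \<longleftrightarrow>
     (\<exists>y\<in>{0..<1}. subword (itinerary \<alpha> \<beta> y) 0 (length w) = w \<and> (beta_map \<alpha> \<beta> ^^ length w) y = z)"
proof (induction w arbitrary: z rule: rev_induct)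
  case Nil
  then show ?case by (simp add: subword_def)
next
  case (snoc i w)
  let ?c = "foldl lower 0 w" and ?d = "foldl upper 1 w"
  have cd: "0 \<le> ?c" "?d \<le> 1" by (simp_all add: foldl_lower_nonneg foldl_upper_le_1)
  have "z \<in> {lower ?c i..<upper ?d i} \<longleftrightarrow>
      (\<exists>x\<in>{?c..<?d}. \<lfloor>\<beta> * x + \<alpha>\<rfloor> = int i \<and> beta_map \<alpha> \<beta> x = z)" (is "?l \<longleftrightarrow> ?r")
  proof
    assume l: ?l
    \<comment> \<open>The preimage of \<open>z\<close> under the affine extension of branch
      \<open>i\<close>.\<close>
    define x where "x = (z + real i - \<alpha>) / \<beta>"
    have x: "\<beta> * x + \<alpha> = z + real i" using \<beta>_gt_1 by (simp add: x_def)
    have "\<beta> * ?c \<le> \<beta> * x" "\<beta> * x < \<beta> * ?d" "0 \<le> z" "z < 1"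
      using l x by (auto simp: lower_def upper_def)
    moreover from this have "\<lfloor>\<beta> * x + \<alpha>\<rfloor> = int i" unfolding x by linarith
    ultimately show ?r using \<beta>_gt_1 x by (intro bexI[of _ x]) (auto simp: beta_map_def)
  next
    assume ?r
    then obtain x where x: "x \<in> {?c..<?d}" "\<lfloor>\<beta> * x + \<alpha>\<rfloor> = int i" "beta_map \<alpha> \<beta> x = z" by blast
    have "\<beta> * ?c \<le> \<beta> * x" "\<beta> * x < \<beta> * ?d" using x(1) \<beta>_gt_1 by auto
    moreover have "z = \<beta> * x + \<alpha> - real i" using x(2,3) by (simp add: beta_map_def)
    moreover have "0 \<le> z" "z < 1" using x(3) beta_map_bounds[of \<alpha> \<beta> x] by auto
    ultimately show ?l by (auto simp: lower_def upper_def)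
  qed
  also have "\<dots> \<longleftrightarrow> (\<exists>y\<in>{0..<1}. subword (itinerary \<alpha> \<beta> y) 0 (length w) = w \<and>
      \<lfloor>\<beta> * (beta_map \<alpha> \<beta> ^^ length w) y + \<alpha>\<rfloor> = int i \<and>
      beta_map \<alpha> \<beta> ((beta_map \<alpha> \<beta> ^^ length w) y) = z)"
    unfolding Bex_def[of "{?c..<?d}"] snoc.IH by blast
  also have "\<dots> \<longleftrightarrow> (\<exists>y\<in>{0..<1}. subword (itinerary \<alpha> \<beta> y) 0 (length (w @ [i])) = w @ [i] \<and>
      (beta_map \<alpha> \<beta> ^^ length (w @ [i])) y = z)"
    by (rule bex_cong[OF refl]) (simp add: subword_Suc itinerary_iff_floor conj_assoc)
  finally show ?case by simp
qed

lemma mem_language_iff: "w \<in> language (beta_shift \<alpha> \<beta>) \<longleftrightarrow> admissible 0 1 w"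
proof -
  have "w \<in> language (beta_shift \<alpha> \<beta>) \<longleftrightarrow>
      (\<exists>y\<in>{0..<1}. subword (itinerary \<alpha> \<beta> y) 0 (length w) = w)"
    unfolding beta_shift_def language_closure by (simp add: language_def)
  also have "\<dots> \<longleftrightarrow> (\<exists>z. z \<in> {foldl lower 0 w..<foldl upper 1 w})"
    unfolding follower_interval by blast
  also have "\<dots> \<longleftrightarrow> admissible 0 1 w"
    unfolding admissible_def by (auto intro: exI[of _ "foldl lower 0 w"])
  finally show ?thesis .
qed

lemma mem_beta_shift_iff: "x \<in> beta_shift \<alpha> \<beta> \<longleftrightarrow> (\<forall>n. admissible 0 1 (subword x 0 n))"
proof
  assume "x \<in> beta_shift \<alpha> \<beta>"
  then show "\<forall>n. admissible 0 1 (subword x 0 n)"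
    unfolding mem_language_iff[symmetric] language_def by auto
next
  assume adm: "\<forall>n. admissible 0 1 (subword x 0 n)"
  show "x \<in> beta_shift \<alpha> \<beta>"
  proof (rule mem_closed_if_prefixes)
    show "closed (beta_shift \<alpha> \<beta>)" by (simp add: beta_shift_def)
    fix n
    have "subword x 0 n \<in> language (beta_shift \<alpha> \<beta>)"
      using adm mem_language_iff by blast
    then show "\<exists>y\<in>beta_shift \<alpha> \<beta>. \<forall>i<n. y i = x i"
      unfolding language_def by (auto simp: subword_eq_iff)
  qed
qed

subsection \<open>The orbits of the endpoints\<close>

definition zero_orbit :: "nat \<Rightarrow> real" where
  "zero_orbit k = (beta_map \<alpha> \<beta> ^^ k) 0"

definition zero_digit :: "nat \<Rightarrow> nat" where
  "zero_digit k = nat \<lfloor>\<beta> * zero_orbit k + \<alpha>\<rfloor>"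

text \<open>The left limits of the iterates of \<open>F\<close> at \<open>1\<close>; they lie in \<open>(0,1]\<close>.\<close>

fun one_orbit :: "nat \<Rightarrow> real" where
  "one_orbit 0 = 1"
| "one_orbit (Suc k) = \<beta> * one_orbit k + \<alpha> - of_int (\<lceil>\<beta> * one_orbit k + \<alpha>\<rceil> - 1)"

declare one_orbit.simps(2) [simp del]

text \<open>Ceiling minus one instead of floor: if \<beta> y + \<alpha> is an integer, the points
  just to the left of y have the digit one smaller.\<close>

definition one_digit :: "nat \<Rightarrow> nat" where
  "one_digit k = nat (\<lceil>\<beta> * one_orbit k + \<alpha>\<rceil> - 1)"

lemma zero_orbit_0 [simp]: "zero_orbit 0 = 0"
  by (simp add: zero_orbit_def)

lemma zero_orbit_bounds: "0 \<le> zero_orbit k" "zero_orbit k < 1"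
  using funpow_beta_map_mem[of 0 k] by (auto simp: zero_orbit_def)

lemma one_orbit_bounds: "0 < one_orbit k" "one_orbit k \<le> 1"
  by (cases k; simp add: one_orbit.simps(2); linarith)+

lemma int_zero_digit: "int (zero_digit k) = \<lfloor>\<beta> * zero_orbit k + \<alpha>\<rfloor>"
  using zero_orbit_bounds[of k] \<alpha>_nonneg \<beta>_gt_1 by (simp add: zero_digit_def)

lemma int_one_digit: "int (one_digit k) = \<lceil>\<beta> * one_orbit k + \<alpha>\<rceil> - 1"
proof -
  have "0 < \<beta> * one_orbit k + \<alpha>"
    using one_orbit_bounds[of k] \<alpha>_nonneg \<beta>_gt_1 by (simp add: add_pos_nonneg)
  then have "0 < \<lceil>\<beta> * one_orbit k + \<alpha>\<rceil>" by simp
  then show ?thesis by (simp add: one_digit_def)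
qed

lemma zero_orbit_Suc: "zero_orbit (Suc k) = \<beta> * zero_orbit k + \<alpha> - real (zero_digit k)"
  using arg_cong[OF int_zero_digit[of k], of real_of_int] by (simp add: zero_orbit_def beta_map_def)

lemma one_orbit_Suc: "one_orbit (Suc k) = \<beta> * one_orbit k + \<alpha> - real (one_digit k)"
  using arg_cong[OF int_one_digit[of k], of real_of_int] by (simp add: one_orbit.simps(2))

lemma lower_zero_orbit: "lower (zero_orbit k) (zero_digit k) = zero_orbit (Suc k)"
  using zero_orbit_bounds[of "Suc k"] by (simp add: lower_def zero_orbit_Suc)

lemma upper_one_orbit: "upper (one_orbit k) (one_digit k) = one_orbit (Suc k)"
  using one_orbit_bounds[of "Suc k"] unfolding upper_def one_orbit_Suc by simp

text \<open>A larger digit selects a branch starting to the right of the orbit point, so the image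
  starts afresh at 0. With its mirror image below, this is the mechanism for resetting an
  endpoint.\<close>

lemma lower_zero_orbit_greater:
  assumes "zero_digit k < i"
  shows "lower (zero_orbit k) i = 0"
  using assms zero_orbit_bounds[of "Suc k"] by (auto simp: lower_def zero_orbit_Suc)

lemma upper_one_orbit_less:
  assumes "i < one_digit k"
  shows "upper (one_orbit k) i = 1"
  using assms one_orbit_bounds[of "Suc k"] unfolding upper_def one_orbit_Suc by auto

lemma lower_lt_1_iff: "lower (zero_orbit k) i < 1 \<longleftrightarrow> zero_digit k \<le> i"
  using int_zero_digit[of k] unfolding lower_def by linarith

lemma upper_gt_0_iff: "0 < upper (one_orbit k) i \<longleftrightarrow> i \<le> one_digit k"
  using int_one_digit[of k] unfolding upper_def by linarith

lemma foldl_lower_zero: "foldl lower (zero_orbit k) (subword zero_digit k n) = zero_orbit (k + n)"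
  by (induction n) (simp_all add: subword_def lower_zero_orbit)

lemma foldl_upper_one: "foldl upper (one_orbit k) (subword one_digit k n) = one_orbit (k + n)"
  by (induction n) (simp_all add: subword_def upper_one_orbit)

text \<open>An interval between two orbit points only meets branches between those of the two
  points. All lexicographic constraints come from here.\<close>

lemma digit_bounds_if_admissible:
  assumes "admissible c d (i # w)" "zero_orbit k \<le> c" "d \<le> one_orbit m"
  shows "zero_digit k \<le> i" "i \<le> one_digit m"
proof -
  have lt: "lower c i < upper d i"
    using assms(1) admissible_imp_less by (simp add: admissible_def)
  have "lower (zero_orbit k) i \<le> lower c i" "upper d i \<le> upper (one_orbit m) i"
    using assms by (simp_all add: lower_mono upper_mono)
  moreover have "0 \<le> lower c i" "upper d i \<le> 1" by (simp_all add: lower_def upper_def)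
  ultimately show "zero_digit k \<le> i" "i \<le> one_digit m"
    unfolding lower_lt_1_iff[symmetric] upper_gt_0_iff[symmetric] using lt by linarith+
qed

lemma orbit_less_imp_digit_le:
  assumes "zero_orbit k < one_orbit m"
  shows "zero_digit k \<le> one_digit m"
proof -
  have "\<beta> * zero_orbit k + \<alpha> < \<beta> * one_orbit m + \<alpha>" using assms \<beta>_gt_1 by simp
  then show ?thesis using int_zero_digit[of k] int_one_digit[of m] by linarith
qed

lemma orbit_less_Suc:
  assumes "zero_orbit k < one_orbit m" "zero_digit k = one_digit m"
  shows "zero_orbit (Suc k) < one_orbit (Suc m)"
  using assms \<beta>_gt_1 unfolding zero_orbit_Suc one_orbit_Suc by simp

lemma orbit_less_add:
  assumes "zero_orbit k < one_orbit m" "subword zero_digit k j = subword one_digit m j"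
  shows "zero_orbit (k + j) < one_orbit (m + j)"
  using assms(2)
proof (induction j)
  case 0
  then show ?case using assms(1) by simp
next
  case (Suc j)
  then show ?case using orbit_less_Suc[of "k + j" "m + j"] by (simp add: subword_Suc)
qed

lemma admissible_zero_prefix: "admissible 0 1 (subword zero_digit 0 n)"
proof -
  have "\<exists>y\<in>{0..<1}. subword (itinerary \<alpha> \<beta> y) 0 n = subword zero_digit 0 n"
  proof (rule bexI[of _ 0])
    have "itinerary \<alpha> \<beta> 0 = zero_digit"
      by (rule ext, subst itinerary_iff_floor) (simp_all add: int_zero_digit flip: zero_orbit_def)
    then show "subword (itinerary \<alpha> \<beta> 0) 0 n = subword zero_digit 0 n" by simp
  qed simp
  then show ?thesis using follower_interval[of _ "subword zero_digit 0 n"]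
    unfolding admissible_def by (auto intro: le_less_trans)
qed

text \<open>The point 1 lies outside the domain, so no itinerary is at hand. Instead the left end is
  kept strictly below the orbit of 1; clipping at 0 does no harm since that orbit is
  positive.\<close>

lemma admissible_one_prefix: "admissible 0 1 (subword one_digit 0 n)"
proof -
  have "foldl lower 0 (subword one_digit 0 n) < one_orbit n"
  proof (induction n)
    case (Suc n)
    define c where "c = foldl lower 0 (subword one_digit 0 n)"
    have "\<beta> * c < \<beta> * one_orbit n" using Suc \<beta>_gt_1 by (simp add: c_def)
    then have "lower c (one_digit n) < one_orbit (Suc n)"
      using one_orbit_bounds[of "Suc n"] unfolding lower_def one_orbit_Suc by simp
    then show ?case by (simp add: subword_Suc c_def)
  qed (simp add: subword_def)
  then show ?thesis
    using foldl_upper_one[of 0 n] by (simp add: admissible_def)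
qed

text \<open>As long as \<open>x\<close> follows one of the two sequences, the matching endpoint is
  on its orbit and bounds the next symbol.\<close>

lemma mem_beta_shift_first_difference:
  assumes x: "x \<in> beta_shift \<alpha> \<beta>"
  shows "(\<forall>i<k. x i = zero_digit i) \<Longrightarrow> zero_digit k \<le> x k"
    and "(\<forall>i<k. x i = one_digit i) \<Longrightarrow> x k \<le> one_digit k"
proof -
  define w where "w = subword x 0 k"
  have adm: "admissible (foldl lower 0 w) (foldl upper 1 w) [x k]"
    using x[unfolded mem_beta_shift_iff, rule_format, of "Suc k"]
    by (simp add: subword_Suc admissible_append w_def)
  show "zero_digit k \<le> x k" if "\<forall>i<k. x i = zero_digit i"
  proof (rule digit_bounds_if_admissible(1)[OF adm, where m = 0])
    have "w = subword zero_digit 0 k" using that by (simp add: w_def subword_eq_iff)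
    then show "zero_orbit k \<le> foldl lower 0 w" using foldl_lower_zero[of 0 k] by simp
  qed (simp add: foldl_upper_le_1)
  show "x k \<le> one_digit k" if "\<forall>i<k. x i = one_digit i"
  proof (rule digit_bounds_if_admissible(2)[OF adm, where k = 0])
    have "w = subword one_digit 0 k" using that by (simp add: w_def subword_eq_iff)
    then show "foldl upper 1 w \<le> one_orbit k" using foldl_upper_one[of 0 k] by simp
  qed (simp add: foldl_lower_nonneg)
qed

lemma lex_least_zero_digit: "lex_least (beta_shift \<alpha> \<beta>) zero_digit"
  unfolding lex_least_def
proof (intro conjI ballI)
  show "zero_digit \<in> beta_shift \<alpha> \<beta>"
    unfolding mem_beta_shift_iff using admissible_zero_prefix by blast
  fix x assume x: "x \<in> beta_shift \<alpha> \<beta>"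
  show "zero_digit = x \<or> less_fun zero_digit x"
  proof (cases "x = zero_digit")
    case False
    then obtain k where k: "x k \<noteq> zero_digit k" "\<forall>i<k. x i = zero_digit i"
      by (rule first_difference)
    then have "zero_digit k < x k" using mem_beta_shift_first_difference(1)[OF x, of k] by simp
    then show ?thesis using k(2) unfolding less_fun_def by metis
  qed simp
qed

lemma lex_greatest_one_digit: "lex_greatest (beta_shift \<alpha> \<beta>) one_digit"
  unfolding lex_greatest_def
proof (intro conjI ballI)
  show "one_digit \<in> beta_shift \<alpha> \<beta>"
    unfolding mem_beta_shift_iff using admissible_one_prefix by blast
  fix x assume x: "x \<in> beta_shift \<alpha> \<beta>"
  show "x = one_digit \<or> less_fun x one_digit"
  proof (cases "x = one_digit")
    case False
    then obtain k where k: "x k \<noteq> one_digit k" "\<forall>i<k. x i = one_digit i"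
      by (rule first_difference)
    then have "x k < one_digit k" using mem_beta_shift_first_difference(2)[OF x, of k] by simp
    then show ?thesis using k(2) unfolding less_fun_def by metis
  qed simp
qed

subsection \<open>Specification implies bounded overlaps\<close>

text \<open>While the digits of both ends agree, each symbol is squeezed between two equal digits,
  and the new interval again lies between the next orbit points.\<close>

lemma forced_word:
  assumes "subword one_digit m n = subword zero_digit k n"
    and "zero_orbit k \<le> c" "d \<le> one_orbit m" "admissible c d u" "length u \<le> n"
  shows "u = subword zero_digit k (length u)"
  using assms
proof (induction u arbitrary: c d k m n)
  case (Cons i u)
  then obtain n' where n: "n = Suc n'" by (cases n) auto
  have eq: "one_digit (m + j) = zero_digit (k + j)" if "j < n" for j
    using Cons.prems(1) that by (simp add: subword_eq_iff)
  have i: "i = zero_digit k" "i = one_digit m"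
    using digit_bounds_if_admissible[OF Cons.prems(4,2,3)] eq[of 0] n by simp_all
  have "u = subword zero_digit (Suc k) (length u)"
  proof (rule Cons.IH)
    show "subword one_digit (Suc m) n' = subword zero_digit (Suc k) n'"
      unfolding subword_eq_iff using eq[of "Suc _"] n by simp
    show "zero_orbit (Suc k) \<le> lower c i"
      unfolding i(1) lower_zero_orbit[symmetric] using Cons.prems(2) by (rule lower_mono)
    show "upper d i \<le> one_orbit (Suc m)"
      unfolding i(2) upper_one_orbit[symmetric] using Cons.prems(3) by (rule upper_mono)
  qed (use Cons.prems n in \<open>simp_all add: admissible_def\<close>)
  then show ?case
    by (subst list_eq_iff_nth_eq) (auto simp: i(1) nth_Cons split: nat.splits, metis nth_subword add_Suc)
qed (simp add: subword_def)

lemma admissible_single: "i \<le> 1 \<Longrightarrow> admissible 0 1 [i]"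
  using \<alpha>_nonneg \<alpha>_less_1 \<beta>_gt_1 by (auto simp: admissible_def lower_def upper_def)

text \<open>If \<open>n\<close> exceeded \<tau>, the gap after \<open>w\<close> and the symbol
  following it would all be forced, although both 0 and 1 can be prescribed as that symbol.\<close>

lemma spec_forced_le:
  assumes spec: "\<And>u v. admissible 0 1 u \<Longrightarrow> admissible 0 1 v \<Longrightarrow>
      \<exists>t. length t = \<tau> \<and> admissible 0 1 (u @ t @ v)"
    and w: "admissible 0 1 w"
    and overlap: "subword one_digit m n = subword zero_digit k n"
    and ends: "zero_orbit k \<le> foldl lower 0 w" "foldl upper 1 w \<le> one_orbit m"
  shows "n \<le> \<tau>"
proof (rule ccontr)
  assume "\<not> n \<le> \<tau>"
  have "i = zero_digit (k + \<tau>)" if i: "i \<le> 1" for i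
  proof -
    obtain t where t: "length t = \<tau>" "admissible 0 1 (w @ t @ [i])"
      using spec[OF w admissible_single[OF i]] by blast
    have "t @ [i] = subword zero_digit k (length (t @ [i]))"
      using forced_word[OF overlap ends, of "t @ [i]"] t \<open>\<not> n \<le> \<tau>\<close>
      unfolding admissible_append[of 0 1 w] by simp
    then show ?thesis using t(1) by (simp add: subword_Suc)
  qed
  from this[of 0] this[of 1] show False by simp
qed

lemma spec_imp_bounded_overlaps:
  assumes "shift_has_spec (beta_shift \<alpha> \<beta>)"
  obtains N where "\<And>n j. subword one_digit 0 n = subword zero_digit j n \<Longrightarrow> n \<le> N"
    and "\<And>n j. subword zero_digit 0 n = subword one_digit j n \<Longrightarrow> n \<le> N"
proof -
  obtain \<tau> where \<tau>: "\<And>(n :: nat) w. (\<forall>i\<le>n. admissible 0 1 (w i)) \<Longrightarrow>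
        (\<exists>v :: nat \<Rightarrow> nat list. (\<forall>i\<in>{1..n}. admissible 0 1 (v i) \<and> length (v i) = \<tau>) \<and>
           admissible 0 1 (w 0 @ concat (map (\<lambda>i. v i @ w i) [1 ..< n + 1])))"
    using assms unfolding shift_has_spec_def words_have_spec_def mem_language_iff by blast
  have spec: "\<exists>t. length t = \<tau> \<and> admissible 0 1 (u @ t @ v)"
    if uv: "admissible 0 1 u" "admissible 0 1 v" for u v
  proof -
    \<comment> \<open>Only the case of two words is needed.\<close>
    have "\<forall>i\<le>(1 :: nat). admissible 0 1 (if i = 0 then u else v)" using uv by simp
    from \<tau>[OF this] show ?thesis by auto
  qed
  show ?thesis
  proof (rule that)
    \<comment> \<open>The prefix of length \<open>j\<close> of the smallest sequence moves the left
      end to \<open>zero_orbit j\<close>; the right end is at most 1 =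
      \<open>one_orbit 0\<close>.\<close>
    show "n \<le> \<tau>" if "subword one_digit 0 n = subword zero_digit j n" for n j
    proof (rule spec_forced_le[OF _ admissible_zero_prefix[of j] that])
      show "zero_orbit j \<le> foldl lower 0 (subword zero_digit 0 j)"
        using foldl_lower_zero[of 0 j] by simp
    qed (use spec in blast, simp add: foldl_upper_le_1)
    show "n \<le> \<tau>" if "subword zero_digit 0 n = subword one_digit j n" for n j
    proof (rule spec_forced_le[OF _ admissible_one_prefix[of j] that[symmetric]])
      show "foldl upper 1 (subword one_digit 0 j) \<le> one_orbit j"
        using foldl_upper_one[of 0 j] by simp
    qed (use spec in blast, simp add: foldl_lower_nonneg)
  qed
qed

subsection \<open>Bounded overlaps imply specification\<close>

text \<open>Each symbol either prolongs the current match with the smallest sequence or exceeds its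
  digit and resets the left end to 0. The matched suffix is recorded in order to detect overlaps
  later.\<close>

lemma lower_end_on_zero_orbit:
  assumes "admissible 0 1 w"
  shows "\<exists>k\<le>length w. foldl lower 0 w = zero_orbit k \<and> drop (length w - k) w = subword zero_digit 0 k"
  using assms
proof (induction w rule: rev_induct)
  case (snoc i w)
  then obtain k where k: "k \<le> length w" "foldl lower 0 w = zero_orbit k"
      "drop (length w - k) w = subword zero_digit 0 k"
    using admissible_appendD1 by blast
  have "zero_digit k \<le> i"
    using snoc.prems unfolding admissible_append k(2)
    by (rule digit_bounds_if_admissible(1)[where m = 0]) (simp_all add: foldl_upper_le_1)
  then consider "i = zero_digit k" | "zero_digit k < i" by linarith
  then show ?case
  proof cases
    case 1
    then show ?thesis using k
      by (intro exI[of _ "Suc k"]) (auto simp: lower_zero_orbit subword_Suc)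
  next
    case 2
    then show ?thesis using k
      by (intro exI[of _ 0]) (auto simp: lower_zero_orbit_greater subword_def)
  qed
qed (simp add: subword_def)

lemma upper_end_on_one_orbit:
  assumes "admissible 0 1 w"
  shows "\<exists>m\<le>length w. foldl upper 1 w = one_orbit m \<and> drop (length w - m) w = subword one_digit 0 m"
  using assms
proof (induction w rule: rev_induct)
  case (snoc i w)
  then obtain m where m: "m \<le> length w" "foldl upper 1 w = one_orbit m"
      "drop (length w - m) w = subword one_digit 0 m"
    using admissible_appendD1 by blast
  have "i \<le> one_digit m"
    using snoc.prems unfolding admissible_append m(2)
    by (rule digit_bounds_if_admissible(2)[where k = 0]) (simp_all add: foldl_lower_nonneg)
  then consider "i = one_digit m" | "i < one_digit m" by linarith
  then show ?case
  proof cases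
    case 1
    then show ?thesis using m
      by (intro exI[of _ "Suc m"]) (auto simp: upper_one_orbit subword_Suc)
  next
    case 2
    then show ?thesis using m
      by (intro exI[of _ 0]) (auto simp: upper_one_orbit_less subword_def)
  qed
qed (simp add: subword_def)

text \<open>Both matches end at the end of \<open>w\<close>, so the shorter one is a suffix of the
  longer one.\<close>

lemma suffix_overlap:
  assumes "drop (length w - k) w = subword x 0 k" "drop (length w - m) w = subword y 0 m"
    and "m \<le> k" "k \<le> length w"
  shows "subword y 0 m = subword x (k - m) m"
proof -
  have "y i = x (k - m + i)" if "i < m" for i
  proof -
    have "y i = drop (length w - m) w ! i" using that assms(2) by simp
    also have "\<dots> = drop (length w - k) w ! (k - m + i)" using that assms(3,4) by simp
    also have "\<dots> = x (k - m + i)" using that assms(1,3) by simp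
    finally show ?thesis .
  qed
  then show ?thesis by (simp add: subword_eq_iff)
qed

lemma subword_append: "subword x i m @ subword x (i + m) n = subword x i (m + n)"
  by (simp add: subword_def add.assoc[symmetric] flip: map_append upt_add_eq_append)

text \<open>At the first difference of the two digit sequences either endpoint can be reset.\<close>

lemma separate_orbits:
  assumes less: "zero_orbit k < one_orbit m"
    and differ: "subword zero_digit k n \<noteq> subword one_digit m n"
  obtains j u v where "j < n" "length u = Suc j" "length v = Suc j"
    and "subword zero_digit k j = subword one_digit m j"
    and "foldl lower (zero_orbit k) u = 0" "foldl upper (one_orbit m) u = one_orbit (Suc (m + j))"
    and "foldl lower (zero_orbit k) v = zero_orbit (Suc (k + j))" "foldl upper (one_orbit m) v = 1"
proof -
  define j where "j = (LEAST j. zero_digit (k + j) \<noteq> one_digit (m + j))"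
  obtain i where i: "i < n" "zero_digit (k + i) \<noteq> one_digit (m + i)"
    using differ by (auto simp: subword_eq_iff)
  have j: "zero_digit (k + j) \<noteq> one_digit (m + j)" unfolding j_def using i(2) by (rule LeastI)
  have "j < n" using i Least_le[of "\<lambda>j. zero_digit (k + j) \<noteq> one_digit (m + j)" i] by (simp add: j_def)
  have eq: "subword zero_digit k j = subword one_digit m j"
    unfolding subword_eq_iff j_def by (auto dest: not_less_Least)
  \<comment> \<open>The left end is still below the right end, so differing digits are
    ordered.\<close>
  have lt: "zero_digit (k + j) < one_digit (m + j)"
    using orbit_less_imp_digit_le[OF orbit_less_add[OF less eq]] j by simp
  let ?w = "subword zero_digit k j"
  have ends: "foldl lower (zero_orbit k) ?w = zero_orbit (k + j)"
      "foldl upper (one_orbit m) ?w = one_orbit (m + j)"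
    using foldl_lower_zero[of k j] foldl_upper_one[of m j] eq by simp_all
  \<comment> \<open>Taking the digit of the right end resets the left end to 0; taking the digit of
    the left end resets the right end to 1.\<close>
  show ?thesis
  proof (rule that[of j "?w @ [one_digit (m + j)]" "?w @ [zero_digit (k + j)]"])
    show "foldl upper (one_orbit m) (?w @ [one_digit (m + j)]) = one_orbit (Suc (m + j))"
      using upper_one_orbit by (simp add: ends)
  qed (use \<open>j < n\<close> lt in \<open>simp_all add: ends lower_zero_orbit lower_zero_orbit_greater upper_one_orbit_less\<close>, rule eq)
qed

text \<open>An interval containing a whole branch becomes [0,1) in one step. Otherwise it meets at
  most two branches, and the longer of the two images has at least \<beta>/2 times its length.
  Lengths never exceed 1, so \<open>M\<close> steps suffice.\<close>

lemma expand_to_full: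
  assumes "2 < \<beta>" "0 \<le> c" "d \<le> 1" "1 < (d - c) * (\<beta> / 2) ^ M"
  shows "\<exists>v. length v \<le> M \<and> foldl lower c v = 0 \<and> foldl upper d v = 1"
  using assms(2-)
proof (induction M arbitrary: c d)
  case (Suc M)
  have "0 < (d - c) * (\<beta> / 2) ^ Suc M" using Suc.prems(3) by linarith
  then have "c < d" using assms(1) by (auto dest: zero_less_mult_pos2)
  have step: ?case
    if "(\<beta> * d - \<beta> * c) / 2 \<le> upper d i - lower c i" for i
  proof -
    have "(\<beta> * d - \<beta> * c) / 2 * (\<beta> / 2) ^ M \<le> (upper d i - lower c i) * (\<beta> / 2) ^ M"
      using assms(1) that by (intro mult_right_mono) auto
    moreover have "1 < (\<beta> * d - \<beta> * c) / 2 * (\<beta> / 2) ^ M" using Suc.prems(3) by (simp add: algebra_simps)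
    ultimately have "1 < (upper d i - lower c i) * (\<beta> / 2) ^ M" by linarith
    moreover have "0 \<le> lower c i" "upper d i \<le> 1" by (simp_all add: lower_def upper_def)
    ultimately obtain v where "length v \<le> M" "foldl lower (lower c i) v = 0" "foldl upper (upper d i) v = 1"
      using Suc.IH by blast
    then show ?case by (intro exI[of _ "i # v"]) simp
  qed
  have cd: "\<beta> * c < \<beta> * d" "0 \<le> \<beta> * c" using \<open>c < d\<close> Suc.prems(1) assms(1) by simp_all
  \<comment> \<open>The first and the last branch met by [c,d); the ceiling accounts for the open
    right end.\<close>
  define p where "p = nat \<lfloor>\<beta> * c + \<alpha>\<rfloor>"
  define q where "q = nat (\<lceil>\<beta> * d + \<alpha>\<rceil> - 1)"
  have p: "real p \<le> \<beta> * c + \<alpha>" "\<beta> * c + \<alpha> < real p + 1"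
    using cd \<alpha>_nonneg unfolding p_def by (simp_all add: of_nat_nat)
  have q: "real q < \<beta> * d + \<alpha>" "\<beta> * d + \<alpha> \<le> real q + 1"
    using cd \<alpha>_nonneg unfolding q_def by (simp_all add: of_nat_nat) linarith+
  have pq: "p \<le> q" using p q cd by linarith
  consider "q = p" | "q = Suc p" | "Suc p < q" using pq by linarith
  then show ?case
  proof cases
    case 1
    then show ?thesis using p q cd by (intro step[of p]) (auto simp: lower_def upper_def)
  next
    case 2
    show ?thesis
    \<comment> \<open>The cut between the two branches is mapped to \<open>real q\<close>; the
      longer piece is kept.\<close>
    proof (cases "real q - (\<beta> * c + \<alpha>) \<ge> (\<beta> * d - \<beta> * c) / 2")
      case True
      then show ?thesis using 2 p q cd by (intro step[of p]) (auto simp: lower_def upper_def)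
    next
      case False
      then show ?thesis using 2 p q cd
        by (intro step[of q]) (auto simp: lower_def upper_def)
    qed
  next
    case 3
    \<comment> \<open>Branch \<open>Suc p\<close> lies strictly between the outer two and is covered
      entirely.\<close>
    then have "real p + 2 \<le> real q" by linarith
    then show ?thesis using p q by (intro exI[of _ "[Suc p]"]) (auto simp: lower_def upper_def)
  qed
qed auto

text \<open>Branch 1 is full because \<alpha> + \<beta> > 2. Its symbol serves as padding that
  brings all gaps to the same length.\<close>

lemma foldl_replicate_1:
  assumes "2 < \<beta>"
  shows "foldl lower 0 (replicate n 1) = 0" "foldl upper 1 (replicate n 1) = 1"
  using assms \<alpha>_nonneg \<alpha>_less_1 by (induction n) (auto simp: lower_def upper_def)

lemma uniform_expansion:
  assumes "2 < \<beta>" "0 < \<delta>"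
  obtains M where "\<And>c d. 0 \<le> c \<Longrightarrow> d \<le> 1 \<Longrightarrow> \<delta> \<le> d - c \<Longrightarrow>
      \<exists>v. length v \<le> M \<and> foldl lower c v = 0 \<and> foldl upper d v = 1"
proof -
  obtain M where M: "1 / \<delta> < (\<beta> / 2) ^ M"
    using real_arch_pow[of "\<beta> / 2" "1 / \<delta>"] assms(1) by auto
  have "1 < (d - c) * (\<beta> / 2) ^ M" if "\<delta> \<le> d - c" for c d
  proof -
    have "1 < \<delta> * (\<beta> / 2) ^ M" using M assms(2) by (simp add: field_simps)
    also have "\<dots> \<le> (d - c) * (\<beta> / 2) ^ M" using that assms(1) by (intro mult_right_mono) auto
    finally show ?thesis .
  qed
  then show ?thesis using that[of M] expand_to_full[OF assms(1)] by blast
qed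

lemma bounded_overlaps_imp_connecting:
  assumes "2 < \<beta>"
    and one_in_zero: "\<And>n j. subword one_digit 0 n = subword zero_digit j n \<Longrightarrow> n \<le> N"
    and zero_in_one: "\<And>n j. subword zero_digit 0 n = subword one_digit j n \<Longrightarrow> n \<le> N"
  obtains \<tau> where "\<tau> \<ge> 1"
    and "\<And>w. admissible 0 1 w \<Longrightarrow>
      \<exists>v. length v = \<tau> \<and> foldl lower 0 (w @ v) = 0 \<and> foldl upper 1 (w @ v) = 1"
proof -
  \<comment> \<open>After a reset the interval is [0, \<open>one_orbit i\<close>) or
    [\<open>zero_orbit i\<close>, 1) with i at most \<open>Suc N\<close>, so only finitely many
    lengths occur.\<close>
  define \<delta> where "\<delta> = Min ((\<lambda>i. min (one_orbit i) (1 - zero_orbit i)) ` {..Suc N})"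
  have "0 < \<delta>"
    unfolding \<delta>_def using one_orbit_bounds zero_orbit_bounds by (subst Min_gr_iff) auto
  have \<delta>: "\<delta> \<le> one_orbit i" "\<delta> \<le> 1 - zero_orbit i" if "i \<le> Suc N" for i
  proof -
    have "\<delta> \<le> min (one_orbit i) (1 - zero_orbit i)" unfolding \<delta>_def using that by (intro Min_le) auto
    then show "\<delta> \<le> one_orbit i" "\<delta> \<le> 1 - zero_orbit i" by simp_all
  qed
  obtain M where M: "\<And>c d. 0 \<le> c \<Longrightarrow> d \<le> 1 \<Longrightarrow> \<delta> \<le> d - c \<Longrightarrow>
      \<exists>v. length v \<le> M \<and> foldl lower c v = 0 \<and> foldl upper d v = 1"
    using uniform_expansion[OF assms(1) \<open>0 < \<delta>\<close>] by blast
  show ?thesis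
  proof (rule that)
    fix w assume w: "admissible 0 1 w"
    obtain k where k: "k \<le> length w" "foldl lower 0 w = zero_orbit k"
        "drop (length w - k) w = subword zero_digit 0 k"
      using lower_end_on_zero_orbit[OF w] by blast
    obtain m where m: "m \<le> length w" "foldl upper 1 w = one_orbit m"
        "drop (length w - m) w = subword one_digit 0 m"
      using upper_end_on_one_orbit[OF w] by blast
    have less: "zero_orbit k < one_orbit m" using w k(2) m(2) by (simp add: admissible_def)
    have "\<exists>u. length u \<le> Suc N \<and> \<delta> \<le> foldl upper (one_orbit m) u - foldl lower (zero_orbit k) u"
    proof (cases "m \<le> k")
      case True
      \<comment> \<open>The last \<open>m\<close> symbols of \<open>w\<close> form a prefix of the
        largest sequence inside the smallest one; \<open>j\<close> further agreements lengthen this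
        occurrence to \<open>m + j\<close>.\<close>
      have overlap: "m + j \<le> N" if "subword zero_digit k j = subword one_digit m j" for j
      proof (rule one_in_zero)
        have "subword one_digit 0 m = subword zero_digit (k - m) m"
          by (rule suffix_overlap[OF k(3) m(3) True k(1)])
        then show "subword one_digit 0 (m + j) = subword zero_digit (k - m) (m + j)"
          using that True subword_append[of one_digit 0 m j] subword_append[of zero_digit "k - m" m j]
          by simp
      qed
      then have "subword zero_digit k (Suc N) \<noteq> subword one_digit m (Suc N)" by fastforce
      then obtain j u where "subword zero_digit k j = subword one_digit m j" "length u = Suc j"
          "foldl lower (zero_orbit k) u = 0" "foldl upper (one_orbit m) u = one_orbit (Suc (m + j))"
        using separate_orbits[OF less] by metis
      then show ?thesis using overlap[of j] \<delta>(1)[of "Suc (m + j)"]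
        by (intro exI[of _ u]) (simp)
    next
      case False
      have overlap: "k + j \<le> N" if "subword zero_digit k j = subword one_digit m j" for j
      proof (rule zero_in_one)
        have "subword zero_digit 0 k = subword one_digit (m - k) k"
          by (rule suffix_overlap[OF m(3) k(3) _ m(1)]) (use False in simp)
        then show "subword zero_digit 0 (k + j) = subword one_digit (m - k) (k + j)"
          using that False subword_append[of zero_digit 0 k j] subword_append[of one_digit "m - k" k j]
          by simp
      qed
      then have "subword zero_digit k (Suc N) \<noteq> subword one_digit m (Suc N)" by fastforce
      then obtain j v where "subword zero_digit k j = subword one_digit m j" "length v = Suc j"
          "foldl lower (zero_orbit k) v = zero_orbit (Suc (k + j))" "foldl upper (one_orbit m) v = 1"
        using separate_orbits[OF less] by metis
      then show ?thesis using overlap[of j] \<delta>(2)[of "Suc (k + j)"]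
        by (intro exI[of _ v]) simp
    qed
    then obtain u where u: "length u \<le> Suc N"
        "\<delta> \<le> foldl upper (one_orbit m) u - foldl lower (zero_orbit k) u"
      by blast
    obtain v where v: "length v \<le> M" "foldl lower (foldl lower (zero_orbit k) u) v = 0"
        "foldl upper (foldl upper (one_orbit m) u) v = 1"
      using M[OF _ _ u(2)] foldl_lower_nonneg foldl_upper_le_1 zero_orbit_bounds(1) one_orbit_bounds(2)
      by blast
    \<comment> \<open>Specification demands gaps of one exact length, whereas \<open>u\<close> and
      \<open>v\<close> are only bounded in length.\<close>
    define r where "r = replicate (Suc N + M - length (u @ v)) (1::nat)"
    have "foldl lower 0 r = 0" "foldl upper 1 r = 1"
      unfolding r_def by (rule foldl_replicate_1[OF assms(1)])+
    moreover have "length (u @ v @ r) = Suc N + M" using u(1) v(1) by (simp add: r_def)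
    ultimately show "\<exists>v. length v = Suc N + M \<and> foldl lower 0 (w @ v) = 0 \<and> foldl upper 1 (w @ v) = 1"
      by (intro exI[of _ "u @ v @ r"]) (simp add: k(2) m(2) v(2,3))
  qed simp
qed

text \<open>Each gap restores the interval [0,1), so the next word is read as if from the start, and
  the final endpoints are those of the last word alone.\<close>

lemma connecting_imp_spec:
  assumes "\<tau> \<ge> 1"
    and "\<And>w. admissible 0 1 w \<Longrightarrow>
      \<exists>v. length v = \<tau> \<and> foldl lower 0 (w @ v) = 0 \<and> foldl upper 1 (w @ v) = 1"
  shows "shift_has_spec (beta_shift \<alpha> \<beta>)"
proof -
  obtain C where C: "length (C w) = \<tau>" "foldl lower 0 (w @ C w) = 0" "foldl upper 1 (w @ C w) = 1"
    if "admissible 0 1 w" for w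
    using assms(2) by metis
  have "\<exists>v. (\<forall>i\<in>{1..n}. admissible 0 1 (v i) \<and> length (v i) = \<tau>) \<and>
           admissible 0 1 (w 0 @ concat (map (\<lambda>i. v i @ w i) [1 ..< n + 1]))"
    if w: "\<forall>i\<le>n. admissible 0 1 (w i)" for n and w :: "nat \<Rightarrow> nat list"
  \<comment> \<open>The gap depends only on the word directly before it.\<close>
  proof (rule exI[of _ "\<lambda>i. C (w (i - 1))"], intro conjI ballI)
    fix i assume "i \<in> {1..n}"
    then have wi: "admissible 0 1 (w (i - 1))" using w by auto
    then have "admissible 0 1 (w (i - 1) @ C (w (i - 1)))" using C by (simp only: admissible_def)
    then show "admissible 0 1 (C (w (i - 1)))" by (rule admissible_appendD2)
    show "length (C (w (i - 1))) = \<tau>" using C wi by blast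
  next
    show "admissible 0 1 (w 0 @ concat (map (\<lambda>i. C (w (i - 1)) @ w i) [1 ..< n + 1]))"
    proof -
      let ?v = "\<lambda>k. w 0 @ concat (map (\<lambda>i. C (w (i - 1)) @ w i) [1 ..< k + 1])"
      have "k \<le> n \<Longrightarrow> foldl lower 0 (?v k) = foldl lower 0 (w k) \<and>
          foldl upper 1 (?v k) = foldl upper 1 (w k)" for k
      proof (induction k)
        case (Suc k)
        have "?v (Suc k) = ?v k @ C (w k) @ w (Suc k)" by simp
        moreover have "admissible 0 1 (w k)" using w Suc.prems by simp
        ultimately show ?case using Suc C[of "w k"] by simp
      qed simp
      from this[of n] show ?thesis using w unfolding admissible_def by simp
    qed
  qed
  then show ?thesis
    unfolding shift_has_spec_def words_have_spec_def mem_language_iff using assms(1) by blast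
qed

end

theorem theorem1p5:
  fixes \<alpha> \<beta> :: real and a b :: "nat \<Rightarrow> nat"
  assumes "0 \<le> \<alpha>" and "\<alpha> < 1" and "\<beta> > 2"
    and "lex_least (beta_shift \<alpha> \<beta>) a"
    and "lex_greatest (beta_shift \<alpha> \<beta>) b"
  shows "shift_has_spec (beta_shift \<alpha> \<beta>) \<longleftrightarrow>
           bdd_above {n. n \<ge> 1 \<and> (\<exists>j. subword b 0 n = subword a j n)} \<and>
           bdd_above {n. n \<ge> 1 \<and> (\<exists>j. subword a 0 n = subword b j n)}"
proof -
  interpret intermediate_beta \<alpha> \<beta> using assms(1-3) by unfold_locales simp_all
  have ab: "a = zero_digit" "b = one_digit"
    using lex_least_unique[OF assms(4) lex_least_zero_digit]
      lex_greatest_unique[OF assms(5) lex_greatest_one_digit] by simp_all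
  show ?thesis
  proof
    assume "shift_has_spec (beta_shift \<alpha> \<beta>)"
    then obtain N where "\<And>n j. subword b 0 n = subword a j n \<Longrightarrow> n \<le> N"
        "\<And>n j. subword a 0 n = subword b j n \<Longrightarrow> n \<le> N"
      unfolding ab by (rule spec_imp_bounded_overlaps) blast
    then show "bdd_above {n. n \<ge> 1 \<and> (\<exists>j. subword b 0 n = subword a j n)} \<and>
        bdd_above {n. n \<ge> 1 \<and> (\<exists>j. subword a 0 n = subword b j n)}"
      by (auto intro!: bdd_aboveI[of _ N])
  next
    assume "bdd_above {n. n \<ge> 1 \<and> (\<exists>j. subword b 0 n = subword a j n)} \<and>
        bdd_above {n. n \<ge> 1 \<and> (\<exists>j. subword a 0 n = subword b j n)}"
    then obtain N N' where N: "\<And>n j. n \<ge> 1 \<Longrightarrow> subword b 0 n = subword a j n \<Longrightarrow> n \<le> N"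
        "\<And>n j. n \<ge> 1 \<Longrightarrow> subword a 0 n = subword b j n \<Longrightarrow> n \<le> N'"
      unfolding bdd_above_def by blast
    \<comment> \<open>The sets contain only n \<ge> 1; for n = 0 the bound is trivial.\<close>
    have "n \<le> max N N'" if "subword one_digit 0 n = subword zero_digit j n" for n j
      using N(1)[of n j] that unfolding ab by (cases "n \<ge> 1") auto
    moreover have "n \<le> max N N'" if "subword zero_digit 0 n = subword one_digit j n" for n j
      using N(2)[of n j] that unfolding ab by (cases "n \<ge> 1") auto
    ultimately obtain \<tau> where "\<tau> \<ge> 1" "\<And>w. admissible 0 1 w \<Longrightarrow>
        \<exists>v. length v = \<tau> \<and> foldl lower 0 (w @ v) = 0 \<and> foldl upper 1 (w @ v) = 1"
      using bounded_overlaps_imp_connecting[OF assms(3)] by blast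
    then show "shift_has_spec (beta_shift \<alpha> \<beta>)" by (rule connecting_imp_spec)
  qed
qed

end
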